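(* Let $g,h$ be smooth, nowhere zero functions of $t$ on an open interval. For a smooth function $w=w(t)$ put $$u=\frac1{2hg}\Big[w(t)-2hg'x+(g'h'-gh'')\frac{y^2}2\Big].$$ Then $u$ is invariant under both $\mathbf x_g$ and $\mathbf y_h$, and $u$ solves the ZK equation $u_{xt}-(uu_x)_x-u_{yy}=0$ if and only if $$g'h'+2hg''-gh''=0.$$ A first integral of this equation is $h'-2\frac{g'}{g}h+\frac Kg=0$ with $K$ constant, which gives $h=\alpha g^2-Kg^2\int g^{-3}\,dt$ with $\alpha$ constant. The corresponding exact solution of the ZK equation is $$u=\frac{w(t)-g^2(2xg'+y^2g'')\big(\alpha-K\int g^{-3}dt\big)}{2g^3\big(\alpha-K\int g^{-3}dt\big)},$$ where $w$ is an arbitrary function of time; for $K=0$ it reduces to $u=\dfrac{w(t)-\alpha g^2(2xg'+y^2g'')}{2\alpha g^3}$.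
   Context: $\mathbf x_g=g\partial_x-g'\partial_u$ and $\mathbf y_h=\tfrac12 yh'\partial_x+h\partial_y-\tfrac12 yh''\partial_u$ are vector fields on $(t,x,y,u)$-space; primes denote $d/dt$. A function $u(t,x,y)$ is invariant under a vector field if the field is tangent to its graph. Indefinite integrals denote a fixed antiderivative. *)

theory Defs
  imports "HOL-Analysis.Analysis"
begin

text \<open>Functions of time are total functions of type \<open>real \<Rightarrow> real\<close>, of which only the values on an
  open interval \<open>T\<close> matter; functions of \<open>(t, x, y)\<close> are considered on \<open>T \<times> \<real> \<times> \<real>\<close>.\<close>

definition smooth_on_interval :: "real set \<Rightarrow> (real \<Rightarrow> real) \<Rightarrow> bool" where
  "smooth_on_interval T f \<longleftrightarrow> (\<forall>k. \<forall>t\<in>T. ((deriv ^^ k) f) differentiable (at t))"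

definition spacetime :: "real set \<Rightarrow> (real \<times> real \<times> real) set" where
  "spacetime T = T \<times> UNIV \<times> UNIV"

definition antiderivative_on :: "real set \<Rightarrow> (real \<Rightarrow> real) \<Rightarrow> (real \<Rightarrow> real) \<Rightarrow> bool" where
  "antiderivative_on T F f \<longleftrightarrow> (\<forall>t\<in>T. (F has_real_derivative f t) (at t))"

definition pd_t :: "(real \<times> real \<times> real \<Rightarrow> real) \<Rightarrow> real \<times> real \<times> real \<Rightarrow> real" where
  "pd_t u = (\<lambda>(t, x, y). deriv (\<lambda>s. u (s, x, y)) t)"

definition pd_x :: "(real \<times> real \<times> real \<Rightarrow> real) \<Rightarrow> real \<times> real \<times> real \<Rightarrow> real" where
  "pd_x u = (\<lambda>(t, x, y). deriv (\<lambda>s. u (t, s, y)) x)"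

definition pd_y :: "(real \<times> real \<times> real \<Rightarrow> real) \<Rightarrow> real \<times> real \<times> real \<Rightarrow> real" where
  "pd_y u = (\<lambda>(t, x, y). deriv (\<lambda>s. u (t, x, s)) y)"

text \<open>\<open>Ck_on k \<Omega> u\<close>: all partial derivatives of \<open>u\<close> up to order \<open>k\<close> exist and are continuous on
  the open set \<open>\<Omega>\<close>. Existence is demanded separately because \<open>deriv\<close> is total.\<close>

fun Ck_on :: "nat \<Rightarrow> (real \<times> real \<times> real) set \<Rightarrow> (real \<times> real \<times> real \<Rightarrow> real) \<Rightarrow> bool" where
  "Ck_on 0 \<Omega> u \<longleftrightarrow> continuous_on \<Omega> u"
| "Ck_on (Suc k) \<Omega> u \<longleftrightarrow>
     continuous_on \<Omega> u \<and>
     (\<forall>(t, x, y)\<in>\<Omega>. (\<lambda>s. u (s, x, y)) differentiable (at t) \<and>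
                    (\<lambda>s. u (t, s, y)) differentiable (at x) \<and>
                    (\<lambda>s. u (t, x, s)) differentiable (at y)) \<and>
     Ck_on k \<Omega> (pd_t u) \<and> Ck_on k \<Omega> (pd_x u) \<and> Ck_on k \<Omega> (pd_y u)"

text \<open>Classical solutions of \<open>u\<^sub>x\<^sub>t - (u u\<^sub>x)\<^sub>x - u\<^sub>y\<^sub>y = 0\<close>.\<close>

definition solves_ZK :: "real set \<Rightarrow> (real \<times> real \<times> real \<Rightarrow> real) \<Rightarrow> bool" where
  "solves_ZK T u \<longleftrightarrow>
     Ck_on 2 (spacetime T) u \<and>
     (\<forall>p\<in>spacetime T. pd_t (pd_x u) p - pd_x (\<lambda>q. u q * pd_x u q) p - pd_y (pd_y u) p = 0)"

text \<open>A vector field on \<open>(t, x, y, u)\<close>-space is given by its components with respect to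
  \<open>\<partial>\<^sub>t, \<partial>\<^sub>x, \<partial>\<^sub>y, \<partial>\<^sub>u\<close>.\<close>

type_synonym vector_field =
  "real \<times> real \<times> real \<times> real \<Rightarrow> real \<times> real \<times> real \<times> real"

definition x_field :: "(real \<Rightarrow> real) \<Rightarrow> vector_field" where
  "x_field g = (\<lambda>(t, x, y, v). (0, g t, 0, - deriv g t))"

definition y_field :: "(real \<Rightarrow> real) \<Rightarrow> vector_field" where
  "y_field h = (\<lambda>(t, x, y, v).
     (0, 1/2 * y * deriv h t, h t, - (1/2 * y * deriv (deriv h) t)))"

definition graph_map ::
  "(real \<times> real \<times> real \<Rightarrow> real) \<Rightarrow> real \<times> real \<times> real \<Rightarrow> real \<times> real \<times> real \<times> real" where
  "graph_map u = (\<lambda>(t, x, y). (t, x, y, u (t, x, y)))"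

text \<open>The tangent space of the graph at \<open>graph_map u p\<close> is the range of the derivative of the
  parametrization \<open>graph_map u\<close> at \<open>p\<close>.\<close>

definition invariant_under ::
  "real set \<Rightarrow> vector_field \<Rightarrow> (real \<times> real \<times> real \<Rightarrow> real) \<Rightarrow> bool" where
  "invariant_under T V u \<longleftrightarrow>
     (\<forall>p\<in>spacetime T. \<exists>D. (graph_map u has_derivative D) (at p) \<and> V (graph_map u p) \<in> range D)"

definition u_inv ::
  "(real \<Rightarrow> real) \<Rightarrow> (real \<Rightarrow> real) \<Rightarrow> (real \<Rightarrow> real) \<Rightarrow> real \<times> real \<times> real \<Rightarrow> real" where
  "u_inv g h w = (\<lambda>(t, x, y).
     1 / (2 * h t * g t) *
       (w t - 2 * h t * deriv g t * x
        + (deriv g t * deriv h t - g t * deriv (deriv h) t) * (y^2 / 2)))"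

text \<open>In \<open>u_exact\<close> the argument \<open>G\<close> stands for the antiderivative \<open>\<integral> g\<^sup>-\<^sup>3 dt\<close>.\<close>

definition u_exact ::
  "(real \<Rightarrow> real) \<Rightarrow> real \<Rightarrow> real \<Rightarrow> (real \<Rightarrow> real) \<Rightarrow> (real \<Rightarrow> real) \<Rightarrow>
   real \<times> real \<times> real \<Rightarrow> real" where
  "u_exact g \<alpha> K G w = (\<lambda>(t, x, y).
     (w t - (g t)^2 * (2 * x * deriv g t + y^2 * deriv (deriv g) t) * (\<alpha> - K * G t))
       / (2 * (g t)^3 * (\<alpha> - K * G t)))"

definition u_exact0 ::
  "(real \<Rightarrow> real) \<Rightarrow> real \<Rightarrow> (real \<Rightarrow> real) \<Rightarrow> real \<times> real \<times> real \<Rightarrow> real" where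
  "u_exact0 g \<alpha> w = (\<lambda>(t, x, y).
     (w t - \<alpha> * (g t)^2 * (2 * x * deriv g t + y^2 * deriv (deriv g) t))
       / (2 * \<alpha> * (g t)^3))"

end

(* Both ansatz functions have the form u = A(t) + B(t) x + C(t) y^2, for which the ZK equation
   collapses to the ordinary differential equation B' - B^2 - 2 C = 0.  With B = -g'/g one has
   B' - B^2 = -g''/g.  The first integral comes from
   (g h' - 2 g' h)' = -(g' h' + 2 h g'' - g h''), and the explicit form of h from
   (h / g^2)' = (g h' - 2 g' h) / g^3. *)

theory Submission
  imports Defs
begin

section \<open>Smooth functions on an open set of times\<close>

text \<open>A derivative depends only on the germ of the function at \<open>t\<close>. This is what
  allows total functions to be handled although their formulas are known only on
  \<open>T\<close>.\<close>

lemma deriv_eq_on_open: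
  fixes f :: "real \<Rightarrow> real"
  assumes "open T" "t \<in> T" "\<And>s. s \<in> T \<Longrightarrow> f s = v s" "(v has_real_derivative d) (at t)"
  shows "(f has_real_derivative d) (at t)"
proof -
  have "\<forall>\<^sub>F s in nhds t. f s = v s"
    using assms(1-3) by (auto simp: eventually_nhds)
  then show ?thesis
    using assms(4) DERIV_cong_ev by blast
qed

lemma smooth_on_interval_deriv:
  assumes "smooth_on_interval T f"
  shows "smooth_on_interval T (deriv f)"
  unfolding smooth_on_interval_def
proof
  fix k
  show "\<forall>t\<in>T. ((deriv ^^ k) (deriv f)) differentiable (at t)"
    using assms[unfolded smooth_on_interval_def, rule_format, of _ "Suc k"]
    by (simp add: funpow_swap1)
qed

lemma smooth_on_interval_has_deriv:
  assumes "smooth_on_interval T f" "t \<in> T"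
  shows "(f has_real_derivative deriv f t) (at t)"
  using assms(1)[unfolded smooth_on_interval_def, rule_format, of t 0] assms(2)
  by (simp add: DERIV_deriv_iff_real_differentiable)

text \<open>Smoothness follows from membership in any class stable under differentiation. Since
  \<open>deriv\<close> may take arbitrary values outside \<open>T\<close>, the class need not
  contain \<open>deriv f\<close> itself, only a function that is a derivative of \<open>f\<close> on
  \<open>T\<close>.\<close>

lemma smooth_on_interval_coinduct:
  assumes "open T" "P f"
    and step: "\<And>f. P f \<Longrightarrow> \<exists>f'. P f' \<and> (\<forall>t\<in>T. (f has_real_derivative f' t) (at t))"
  shows "smooth_on_interval T f"
proof -
  \<comment> \<open>The invariant of the induction: the iterated derivative agrees on
    \<open>T\<close> with a member of the class, without having to belong to it.\<close>
  have approx: "\<exists>v. P v \<and> (\<forall>t\<in>T. (deriv ^^ k) f t = v t)" for k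
  proof (induction k)
    case 0
    then show ?case using \<open>P f\<close> by auto
  next
    case (Suc k)
    then obtain v where v: "P v" "\<And>t. t \<in> T \<Longrightarrow> (deriv ^^ k) f t = v t" by blast
    obtain v' where v': "P v'" "\<forall>t\<in>T. (v has_real_derivative v' t) (at t)"
      using step[OF v(1)] by blast
    have "((deriv ^^ k) f has_real_derivative v' t) (at t)" if "t \<in> T" for t
      by (rule deriv_eq_on_open[OF \<open>open T\<close> that]) (use v(2) v'(2) that in auto)
    then have "(deriv ^^ Suc k) f t = v' t" if "t \<in> T" for t
      using that by (auto intro!: DERIV_imp_deriv)
    with v'(1) show ?case by blast
  qed
  show ?thesis
    unfolding smooth_on_interval_def
  proof (intro allI ballI)
    fix k t assume t: "t \<in> T"
    obtain v where v: "P v" "\<And>t. t \<in> T \<Longrightarrow> (deriv ^^ k) f t = v t" using approx by blast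
    obtain v' where v': "\<forall>t\<in>T. (v has_real_derivative v' t) (at t)"
      using step[OF v(1)] by blast
    have "((deriv ^^ k) f has_real_derivative v' t) (at t)"
      by (rule deriv_eq_on_open[OF \<open>open T\<close> t]) (use v(2) v' t in auto)
    then show "(deriv ^^ k) f differentiable at t"
      using real_differentiable_def by blast
  qed
qed

text \<open>Serves to make an antiderivative smooth. The smooth functions together with
  \<open>f\<close> form a class stable under differentiation.\<close>

lemma smooth_on_interval_of_deriv:
  assumes "open T" "smooth_on_interval T f'"
    and "\<And>t. t \<in> T \<Longrightarrow> (f has_real_derivative f' t) (at t)"
  shows "smooth_on_interval T f"
proof (rule smooth_on_interval_coinduct[where P = "\<lambda>v. v = f \<or> smooth_on_interval T v"])
  show "\<exists>v'. (v' = f \<or> smooth_on_interval T v') \<and> (\<forall>t\<in>T. (v has_real_derivative v' t) (at t))"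
    if "v = f \<or> smooth_on_interval T v" for v
    using that
  proof
    assume "v = f" then show ?thesis using assms by blast
  next
    assume "smooth_on_interval T v"
    then show ?thesis
      using smooth_on_interval_deriv smooth_on_interval_has_deriv by blast
  qed
qed (use assms in auto)

text \<open>The whole algebra generated by smooth functions under sums, products and reciprocals is
  closed under differentiation, so coinduction yields all closure properties at once.\<close>

inductive_set smooth_algebra :: "real set \<Rightarrow> (real \<Rightarrow> real) set" for T where
  base: "smooth_on_interval T f \<Longrightarrow> f \<in> smooth_algebra T"
| const: "(\<lambda>t. c) \<in> smooth_algebra T"
| add: "f \<in> smooth_algebra T \<Longrightarrow> v \<in> smooth_algebra T \<Longrightarrow> (\<lambda>t. f t + v t) \<in> smooth_algebra T"
| mult: "f \<in> smooth_algebra T \<Longrightarrow> v \<in> smooth_algebra T \<Longrightarrow> (\<lambda>t. f t * v t) \<in> smooth_algebra T"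
| inverse: "f \<in> smooth_algebra T \<Longrightarrow> \<forall>t\<in>T. f t \<noteq> 0 \<Longrightarrow> (\<lambda>t. inverse (f t)) \<in> smooth_algebra T"

lemma smooth_algebra_deriv:
  assumes "f \<in> smooth_algebra T"
  shows "\<exists>f'. f' \<in> smooth_algebra T \<and> (\<forall>t\<in>T. (f has_real_derivative f' t) (at t))"
  using assms
proof induction
  case (base f)
  then show ?case
    using smooth_algebra.base smooth_on_interval_deriv smooth_on_interval_has_deriv by blast
next
  case (const c)
  then show ?case using smooth_algebra.const[of 0] by (intro exI[of _ "\<lambda>t. 0"]) auto
next
  case (add f v)
  then obtain f' v' where "f' \<in> smooth_algebra T" "v' \<in> smooth_algebra T"
    "\<forall>t\<in>T. (f has_real_derivative f' t) (at t)" "\<forall>t\<in>T. (v has_real_derivative v' t) (at t)"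
    by blast
  then show ?case
    by (intro exI[of _ "\<lambda>t. f' t + v' t"]) (auto intro: smooth_algebra.add DERIV_add)
next
  case (mult f v)
  then obtain f' v' where "f' \<in> smooth_algebra T" "v' \<in> smooth_algebra T"
    "\<forall>t\<in>T. (f has_real_derivative f' t) (at t)" "\<forall>t\<in>T. (v has_real_derivative v' t) (at t)"
    by blast
  with mult.hyps show ?case
    by (intro exI[of _ "\<lambda>t. f' t * v t + v' t * f t"])
      (auto intro!: smooth_algebra.add smooth_algebra.mult DERIV_mult)
next
  case (inverse f)
  then obtain f' where f': "f' \<in> smooth_algebra T" "\<forall>t\<in>T. (f has_real_derivative f' t) (at t)"
    by blast
  \<comment> \<open>The algebra has no rule for negation, so the sign enters as a constant
    factor.\<close>
  have "(\<lambda>t. -1 * (inverse (f t) * f' t * inverse (f t))) \<in> smooth_algebra T"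
    using inverse.hyps f' by (intro smooth_algebra.mult smooth_algebra.inverse smooth_algebra.const)
  moreover have "\<forall>t\<in>T. ((\<lambda>t. inverse (f t)) has_real_derivative
      -1 * (inverse (f t) * f' t * inverse (f t))) (at t)"
    using f' inverse.hyps by (auto intro!: derivative_eq_intros)
  ultimately show ?case by blast
qed

text \<open>The algebra adds nothing to the smooth functions, so its introduction rules become
  closure properties of smoothness.\<close>

lemma smooth_algebra_iff:
  assumes "open T"
  shows "f \<in> smooth_algebra T \<longleftrightarrow> smooth_on_interval T f"
  using smooth_on_interval_coinduct[where P = "\<lambda>f. f \<in> smooth_algebra T", OF assms]
    smooth_algebra_deriv smooth_algebra.base by blast

section \<open>Closure properties of smooth functions\<close>

context
  fixes T :: "real set"
  assumes T: "open T"
begin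

lemma smooth_const: "smooth_on_interval T (\<lambda>t. c)"
  and smooth_add: "smooth_on_interval T f \<Longrightarrow> smooth_on_interval T v \<Longrightarrow>
    smooth_on_interval T (\<lambda>t. f t + v t)"
  and smooth_mult: "smooth_on_interval T f \<Longrightarrow> smooth_on_interval T v \<Longrightarrow>
    smooth_on_interval T (\<lambda>t. f t * v t)"
  and smooth_inverse: "smooth_on_interval T f \<Longrightarrow> \<forall>t\<in>T. f t \<noteq> 0 \<Longrightarrow>
    smooth_on_interval T (\<lambda>t. inverse (f t))"
  using smooth_algebra.intros[where T = T] unfolding smooth_algebra_iff[OF T] by blast+

lemma smooth_minus:
  assumes "smooth_on_interval T f" shows "smooth_on_interval T (\<lambda>t. - f t)"
  using smooth_mult[OF smooth_const[of "-1"] assms] by simp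

lemma smooth_diff:
  assumes "smooth_on_interval T f" "smooth_on_interval T v"
  shows "smooth_on_interval T (\<lambda>t. f t - v t)"
  using smooth_add[OF assms(1) smooth_minus[OF assms(2)]] by simp

lemma smooth_divide:
  assumes "smooth_on_interval T f" "smooth_on_interval T v" "\<forall>t\<in>T. v t \<noteq> 0"
  shows "smooth_on_interval T (\<lambda>t. f t / v t)"
  using smooth_mult[OF assms(1) smooth_inverse[OF assms(2,3)]] by (simp add: divide_inverse)

lemma smooth_power:
  assumes "smooth_on_interval T f" shows "smooth_on_interval T (\<lambda>t. f t ^ n)"
  by (induction n) (auto intro: smooth_const smooth_mult assms)

lemmas smooth_intros =
  smooth_const smooth_add smooth_mult smooth_minus smooth_diff smooth_divide smooth_power
  smooth_on_interval_deriv

section \<open>Functions quadratic in the space variables\<close>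

context
  fixes u :: "real \<times> real \<times> real \<Rightarrow> real" and A B C D :: "real \<Rightarrow> real"
  assumes u: "\<And>t x y. t \<in> T \<Longrightarrow> u (t, x, y) = A t + B t * x + D t * y + C t * y^2"
begin

lemma quadratic_x: "t \<in> T \<Longrightarrow> ((\<lambda>s. u (t, s, y)) has_real_derivative B t) (at x)"
  by (simp only: u) (auto intro!: derivative_eq_intros)

lemma quadratic_y: "t \<in> T \<Longrightarrow> ((\<lambda>s. u (t, x, s)) has_real_derivative D t + 2 * C t * y) (at y)"
  by (simp only: u) (auto intro!: derivative_eq_intros)

lemma quadratic_t:
  assumes "smooth_on_interval T A" "smooth_on_interval T B" "smooth_on_interval T C"
    "smooth_on_interval T D" "t \<in> T"
  shows "((\<lambda>s. u (s, x, y)) has_real_derivative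
    deriv A t + deriv B t * x + deriv D t * y + deriv C t * y^2) (at t)"
\<comment> \<open>Here the time argument varies, and the quadratic form is available only for times
  in \<open>T\<close>. For the space derivatives \<open>t\<close> stays fixed, so rewriting
  suffices.\<close>
proof (rule deriv_eq_on_open[OF T \<open>t \<in> T\<close> u])
  show "((\<lambda>s. A s + B s * x + D s * y + C s * y^2) has_real_derivative
      deriv A t + deriv B t * x + deriv D t * y + deriv C t * y^2) (at t)"
    using assms by (auto intro!: derivative_eq_intros smooth_on_interval_has_deriv)
qed

lemma pd_x_quadratic: "t \<in> T \<Longrightarrow> pd_x u (t, x, y) = B t"
  unfolding pd_x_def by (simp add: DERIV_imp_deriv[OF quadratic_x])

lemma pd_y_quadratic: "t \<in> T \<Longrightarrow> pd_y u (t, x, y) = D t + 2 * C t * y"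
  unfolding pd_y_def by (simp add: DERIV_imp_deriv[OF quadratic_y])

lemma pd_t_quadratic:
  assumes "smooth_on_interval T A" "smooth_on_interval T B" "smooth_on_interval T C"
    "smooth_on_interval T D" "t \<in> T"
  shows "pd_t u (t, x, y) = deriv A t + deriv B t * x + deriv D t * y + deriv C t * y^2"
  unfolding pd_t_def using DERIV_imp_deriv[OF quadratic_t[OF assms]] by simp

end

section \<open>Regularity, ZK equation and invariance for quadratic functions\<close>

lemma smooth_continuous_on:
  assumes "smooth_on_interval T f"
  shows "continuous_on T f"
  using smooth_on_interval_has_deriv[OF assms]
  by (meson DERIV_isCont continuous_at_imp_continuous_on)

lemma continuous_quadratic:
  assumes "smooth_on_interval T A" "smooth_on_interval T B" "smooth_on_interval T C"
    "smooth_on_interval T D"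
    and u: "\<And>t x y. t \<in> T \<Longrightarrow> u (t, x, y) = A t + B t * x + D t * y + C t * y^2"
  shows "continuous_on (spacetime T) u"
proof -
  have c: "continuous_on (spacetime T) (\<lambda>p. f (fst p))" if "smooth_on_interval T f"
    for f :: "real \<Rightarrow> real"
    by (rule continuous_on_compose2[OF smooth_continuous_on[OF that]])
      (auto simp: spacetime_def intro: continuous_intros)
  have "continuous_on (spacetime T)
    (\<lambda>p. A (fst p) + B (fst p) * fst (snd p) + D (fst p) * snd (snd p) + C (fst p) * (snd (snd p))^2)"
    by (intro continuous_intros c assms)
  then show ?thesis
    by (rule continuous_on_eq) (auto simp: spacetime_def u)
qed

text \<open>The term \<open>D t * y\<close>, absent from the ansatz functions, closes the class
  under all three partial derivatives, since \<open>pd_y\<close> produces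
  \<open>2 * C t * y\<close>. Induction on \<open>k\<close> then works with the coefficients left
  arbitrary.\<close>

lemma Ck_on_quadratic:
  assumes "smooth_on_interval T A" "smooth_on_interval T B" "smooth_on_interval T C"
    "smooth_on_interval T D"
    and "\<And>t x y. t \<in> T \<Longrightarrow> u (t, x, y) = A t + B t * x + D t * y + C t * y^2"
  shows "Ck_on k (spacetime T) u"
  using assms
proof (induction k arbitrary: u A B C D)
  case 0
  then show ?case using continuous_quadratic by simp
next
  case (Suc k)
  note smooth = Suc.prems(1-4) and u = Suc.prems(5)
  have "Ck_on k (spacetime T) (pd_t u)"
    by (rule Suc.IH[of "deriv A" "deriv B" "deriv C" "deriv D"])
      (auto intro: smooth smooth_on_interval_deriv simp: pd_t_quadratic[OF u smooth])
  moreover have "Ck_on k (spacetime T) (pd_x u)"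
    by (rule Suc.IH[of B "\<lambda>t. 0" "\<lambda>t. 0" "\<lambda>t. 0"])
      (auto intro: smooth smooth_intros simp: pd_x_quadratic[OF u])
  moreover have "Ck_on k (spacetime T) (pd_y u)"
    by (rule Suc.IH[of D "\<lambda>t. 0" "\<lambda>t. 0" "\<lambda>t. 2 * C t"])
      (auto intro: smooth smooth_intros simp: pd_y_quadratic[OF u])
  moreover have "\<forall>(t, x, y)\<in>spacetime T. (\<lambda>s. u (s, x, y)) differentiable (at t) \<and>
      (\<lambda>s. u (t, s, y)) differentiable (at x) \<and> (\<lambda>s. u (t, x, s)) differentiable (at y)"
    using quadratic_x[OF u] quadratic_y[OF u] quadratic_t[OF u smooth]
    by (fastforce simp: spacetime_def real_differentiable_def)
  ultimately show ?case
    using continuous_quadratic[OF Suc.prems] by simp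
qed

text \<open>Since \<open>pd_x u\<close> equals \<open>B t\<close>, the three terms of the equation
  are \<open>deriv B t\<close>, \<open>(B t)^2\<close> and \<open>2 * C t\<close>. The space
  variables drop out, which leaves a condition on \<open>t\<close> alone.\<close>

lemma solves_ZK_quadratic_iff:
  assumes smooth: "smooth_on_interval T A" "smooth_on_interval T B" "smooth_on_interval T C"
    and u: "\<And>t x y. t \<in> T \<Longrightarrow> u (t, x, y) = A t + B t * x + C t * y^2"
  shows "solves_ZK T u \<longleftrightarrow> (\<forall>t\<in>T. deriv B t - (B t)^2 - 2 * C t = 0)"
proof -
  have u': "u (t, x, y) = A t + B t * x + 0 * y + C t * y^2" if "t \<in> T" for t x y
    using u[OF that] by simp
  have ux: "pd_x u (t, x, y) = B t + 0 * x + 0 * y + 0 * y^2" if "t \<in> T" for t x y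
    using pd_x_quadratic[where u = u and D = "\<lambda>t. 0", OF u' that] by simp
  have uy: "pd_y u (t, x, y) = 0 + 0 * x + (2 * C t) * y + 0 * y^2" if "t \<in> T" for t x y
    using pd_y_quadratic[where u = u and D = "\<lambda>t. 0", OF u' that] by simp
  \<comment> \<open>The product is again quadratic in space, and its \<open>x\<close>-derivative is
    the coefficient \<open>(B t)^2\<close>.\<close>
  have uux: "u (t, x, y) * pd_x u (t, x, y) =
      A t * B t + (B t)^2 * x + 0 * y + (B t * C t) * y^2" if "t \<in> T" for t x y
    using u'[OF that] ux[OF that] by (simp add: algebra_simps power2_eq_square)
  have "pd_t (pd_x u) (t, x, y) - pd_x (\<lambda>q. u q * pd_x u q) (t, x, y) - pd_y (pd_y u) (t, x, y)
      = deriv B t - (B t)^2 - 2 * C t" if "t \<in> T" for t x y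
    using pd_t_quadratic[where u = "pd_x u" and A = B and B = "\<lambda>t. 0" and C = "\<lambda>t. 0"
        and D = "\<lambda>t. 0", OF ux _ _ _ _ that, of x y]
      pd_x_quadratic[where u = "\<lambda>q. u q * pd_x u q" and B = "\<lambda>t. (B t)^2" and D = "\<lambda>t. 0",
        OF uux that, of x y]
      pd_y_quadratic[where u = "pd_y u" and B = "\<lambda>t. 0" and C = "\<lambda>t. 0" and D = "\<lambda>t. 2 * C t",
        OF uy that, of x y] smooth that
    by (simp add: smooth_const)
  moreover have "Ck_on 2 (spacetime T) u"
    by (rule Ck_on_quadratic[of A B C "\<lambda>t. 0"]) (use smooth smooth_const u' in auto)
  ultimately show ?thesis
    unfolding solves_ZK_def by (auto simp: spacetime_def)
qed

text \<open>The tangent vector of the graph over \<open>(0, a, b)\<close> has \<open>u\<close>-component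
  \<open>a u\<^sub>x + b u\<^sub>y\<close>.\<close>

lemma invariant_under_quadratic:
  assumes smooth: "smooth_on_interval T A" "smooth_on_interval T B" "smooth_on_interval T C"
    and u: "\<And>t x y. t \<in> T \<Longrightarrow> u (t, x, y) = A t + B t * x + C t * y^2"
    and V: "\<And>t x y. t \<in> T \<Longrightarrow> \<exists>a b. V (t, x, y, u (t, x, y)) = (0, a, b, B t * a + 2 * C t * y * b)"
  shows "invariant_under T V u"
  unfolding invariant_under_def
proof
  fix p assume "p \<in> spacetime T"
  then obtain t x y where p: "p = (t, x, y)" "t \<in> T" by (auto simp: spacetime_def)
  have comp: "((\<lambda>q. f (fst q)) has_derivative (\<lambda>d. deriv f t * fst d)) (at p)"
    if "smooth_on_interval T f" for f :: "real \<Rightarrow> real"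
  proof -
    have "(f has_derivative (\<lambda>d. deriv f t * d)) (at (fst p))"
      using smooth_on_interval_has_deriv[OF that p(2)] p by (simp add: has_field_derivative_def)
    from has_derivative_compose[OF has_derivative_fst[OF has_derivative_ident] this]
    show ?thesis .
  qed
  \<comment> \<open>The differential of \<open>A + B x + C y^2\<close> at \<open>p\<close>, in the
    shape in which the product rule delivers it.\<close>
  let ?D = "\<lambda>d. deriv A t * fst d + (B t * fst (snd d) + deriv B t * fst d * x)
    + (C t * (2 * y * snd (snd d)) + deriv C t * fst d * y^2)"
  have x: "((\<lambda>q. fst (snd q)) has_derivative (\<lambda>d. fst (snd d))) (at p)"
    by (intro has_derivative_fst has_derivative_snd has_derivative_ident)
  have y: "((\<lambda>q. (snd (snd q))^2) has_derivative (\<lambda>d. 2 * y * snd (snd d))) (at p)"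
    by (auto intro!: derivative_eq_intros simp: p)
  have "((\<lambda>q. A (fst q) + B (fst q) * fst (snd q) + C (fst q) * (snd (snd q))^2)
      has_derivative ?D) (at p)"
    using has_derivative_add[OF has_derivative_add[OF comp[OF smooth(1)]
          has_derivative_mult[OF comp[OF smooth(2)] x]] has_derivative_mult[OF comp[OF smooth(3)] y]]
    by (simp add: p)
  then have "(u has_derivative ?D) (at p)"
    by (rule has_derivative_transform_within_open[where s = "spacetime T"])
      (use T p u in \<open>auto simp: spacetime_def open_Times\<close>)
  then have "((\<lambda>q. (fst q, fst (snd q), snd (snd q), u q))
      has_derivative (\<lambda>d. (fst d, fst (snd d), snd (snd d), ?D d))) (at p)"
    by (intro has_derivative_Pair has_derivative_fst has_derivative_snd has_derivative_ident)
  moreover have "graph_map u = (\<lambda>q. (fst q, fst (snd q), snd (snd q), u q))"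
    by (auto simp: graph_map_def)
  ultimately have "(graph_map u
      has_derivative (\<lambda>d. (fst d, fst (snd d), snd (snd d), ?D d))) (at p)" by simp
  moreover obtain a b where "V (graph_map u p) = (0, a, b, B t * a + 2 * C t * y * b)"
    using V[OF p(2), of x y] by (auto simp: graph_map_def p)
  \<comment> \<open>With time component 0, every term of \<open>?D\<close> containing a derivative
    of \<open>A\<close>, \<open>B\<close> or \<open>C\<close> vanishes.\<close>
  then have "V (graph_map u p) = (\<lambda>d. (fst d, fst (snd d), snd (snd d), ?D d)) (0, a, b)"
    by simp
  ultimately show "\<exists>D. (graph_map u has_derivative D) (at p) \<and> V (graph_map u p) \<in> range D"
    by blast
qed

end

section \<open>The equation for the coefficient functions\<close>

text \<open>Used for both integrations. From left to right the connectedness of \<open>T\<close>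
  gives a single constant; from right to left the openness of \<open>T\<close> lets the constant be
  differentiated.\<close>

lemma constant_on_interval_iff:
  fixes f :: "real \<Rightarrow> real"
  assumes "open T" "is_interval T"
    and f: "\<And>t. t \<in> T \<Longrightarrow> (f has_real_derivative f' t) (at t)"
  shows "(\<forall>t\<in>T. f' t = 0) \<longleftrightarrow> (\<exists>c. \<forall>t\<in>T. f t = c)"
proof
  assume "\<forall>t\<in>T. f' t = 0"
  then have "\<exists>c. \<forall>t\<in>T. f t = c"
    by (intro has_field_derivative_zero_constant is_interval_convex assms(2))
      (metis f has_field_derivative_at_within)
  then show "\<exists>c. \<forall>t\<in>T. f t = c" .
next
  assume "\<exists>c. \<forall>t\<in>T. f t = c"
  then obtain c where "\<And>t. t \<in> T \<Longrightarrow> f t = c" by blast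
  then have "(f has_real_derivative 0) (at t)" if "t \<in> T" for t
    using deriv_eq_on_open[OF assms(1) that, of f "\<lambda>_. c"] by auto
  then show "\<forall>t\<in>T. f' t = 0" using f DERIV_unique by blast
qed

context
  fixes T :: "real set" and g h :: "real \<Rightarrow> real"
  assumes T: "open T" "is_interval T"
    and g: "smooth_on_interval T g" "\<forall>t\<in>T. g t \<noteq> 0"
    and h: "smooth_on_interval T h"
begin

text \<open>The left side of the equation is an exact derivative. Dividing its constant
  antiderivative by \<open>g\<close> gives the stated form.\<close>

lemma first_integral:
  "(\<forall>t\<in>T. deriv g t * deriv h t + 2 * h t * deriv (deriv g) t - g t * deriv (deriv h) t = 0) \<longleftrightarrow>
    (\<exists>K. \<forall>t\<in>T. deriv h t - 2 * (deriv g t / g t) * h t + K / g t = 0)"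
proof -
  \<comment> \<open>The sign is chosen so that the constant value of this function is
    \<open>K\<close> itself.\<close>
  have d: "((\<lambda>t. 2 * deriv g t * h t - g t * deriv h t) has_real_derivative
      deriv g t * deriv h t + 2 * h t * deriv (deriv g) t - g t * deriv (deriv h) t) (at t)"
    if "t \<in> T" for t
    using g h that
    by (auto intro!: derivative_eq_intros smooth_on_interval_has_deriv smooth_on_interval_deriv
        simp: algebra_simps)
  have e: "2 * deriv g t * h t - g t * deriv h t = K \<longleftrightarrow>
      deriv h t - 2 * (deriv g t / g t) * h t + K / g t = 0" if "t \<in> T" for t K
    using g(2) that by (auto simp: field_simps)
  have "(\<forall>t\<in>T. deriv g t * deriv h t + 2 * h t * deriv (deriv g) t - g t * deriv (deriv h) t = 0)
      \<longleftrightarrow> (\<exists>K. \<forall>t\<in>T. 2 * deriv g t * h t - g t * deriv h t = K)"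
    by (rule constant_on_interval_iff[OF T d])
  then show ?thesis
    by (rule trans) (intro ex_cong1 ball_cong refl e)
qed

text \<open>The integrating factor is \<open>1 / (g t)^2\<close>: it turns the linear first-order
  equation into the vanishing of the derivative of \<open>h / g^2 + K * G\<close>, whose constant
  value is \<open>\<alpha>\<close>.\<close>

lemma first_integral_solution:
  assumes G: "antiderivative_on T G (\<lambda>t. 1 / (g t)^3)"
  shows "(\<forall>t\<in>T. deriv h t - 2 * (deriv g t / g t) * h t + K / g t = 0) \<longleftrightarrow>
    (\<exists>\<alpha>. \<forall>t\<in>T. h t = \<alpha> * (g t)^2 - K * (g t)^2 * G t)"
proof -
  have d: "((\<lambda>t. h t / (g t)^2 + K * G t) has_real_derivative
      (deriv h t - 2 * (deriv g t / g t) * h t + K / g t) / (g t)^2) (at t)"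
    if "t \<in> T" for t
  proof -
    have "((\<lambda>t. h t / (g t)^2 + K * G t) has_real_derivative
        (deriv h t * (g t)^2 - h t * (2 * deriv g t * g t)) / ((g t)^2 * (g t)^2)
        + K * (1 / (g t)^3)) (at t)"
      using g h that G[unfolded antiderivative_on_def]
      by (auto intro!: derivative_eq_intros smooth_on_interval_has_deriv)
    then show ?thesis
      by (rule DERIV_cong) (use g(2) that in \<open>simp add: field_simps power2_eq_square power3_eq_cube\<close>)
  qed
  have e: "h t / (g t)^2 + K * G t = \<alpha> \<longleftrightarrow> h t = \<alpha> * (g t)^2 - K * (g t)^2 * G t"
    if "t \<in> T" for t \<alpha>
    using g(2) that by (auto simp: field_simps)
  have "(\<forall>t\<in>T. deriv h t - 2 * (deriv g t / g t) * h t + K / g t = 0) \<longleftrightarrow>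
      (\<forall>t\<in>T. (deriv h t - 2 * (deriv g t / g t) * h t + K / g t) / (g t)^2 = 0)"
    using g(2) by (intro ball_cong refl) simp
  also have "\<dots> \<longleftrightarrow> (\<exists>\<alpha>. \<forall>t\<in>T. h t / (g t)^2 + K * G t = \<alpha>)"
    by (rule constant_on_interval_iff[OF T d])
  finally show ?thesis
    by (rule trans) (intro ex_cong1 ball_cong refl e)
qed

lemma u_inv_eq_u_exact:
  assumes G: "antiderivative_on T G (\<lambda>t. 1 / (g t)^3)"
    and h_eq: "\<forall>t\<in>T. h t = \<alpha> * (g t)^2 - K * (g t)^2 * G t"
    and h_nz: "\<forall>t\<in>T. h t \<noteq> 0"
  shows "\<forall>p\<in>spacetime T. u_inv g h w p = u_exact g \<alpha> K G w p"
proof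
  fix p assume "p \<in> spacetime T"
  then obtain t x y where p: "p = (t, x, y)" "t \<in> T" by (auto simp: spacetime_def)
  \<comment> \<open>Keeping this factor atomic lets \<open>field_simps\<close> cancel it as a
    nonzero quantity.\<close>
  define k where "k = \<alpha> - K * G t"
  \<comment> \<open>Both equivalences are read from right to left, which avoids differentiating the
    formula for \<open>h\<close> twice. The equation then removes all derivatives of
    \<open>h\<close> from the coefficient of \<open>y^2\<close>.\<close>
  have "deriv g t * deriv h t + 2 * h t * deriv (deriv g) t - g t * deriv (deriv h) t = 0"
    using first_integral first_integral_solution[OF G] h_eq p(2) by blast
  then have ode: "deriv g t * deriv h t - g t * deriv (deriv h) t = - 2 * h t * deriv (deriv g) t"
    by simp
  have hk: "h t = (g t)^2 * k" using h_eq p(2) by (simp add: k_def algebra_simps)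
  have nz: "g t \<noteq> 0" "k \<noteq> 0" using g(2) h_nz p(2) hk by auto
  show "u_inv g h w p = u_exact g \<alpha> K G w p"
    unfolding p u_inv_def u_exact_def prod.case ode k_def[symmetric] unfolding hk
    using nz by (simp add: field_simps power2_eq_square power3_eq_cube)
qed

end

section \<open>The ZK equation for functions with \<open>x\<close>-coefficient
  \<open>-g'/g\<close>\<close>

lemma deriv_minus_log_deriv:
  assumes "smooth_on_interval T g" "t \<in> T" "g t \<noteq> 0"
  shows "((\<lambda>t. - (deriv g t / g t)) has_real_derivative
    (deriv g t / g t)^2 - deriv (deriv g) t / g t) (at t)"
proof -
  have "((\<lambda>t. - (deriv g t / g t)) has_real_derivative
      - ((deriv (deriv g) t * g t - deriv g t * deriv g t) / (g t * g t))) (at t)"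
    using assms
    by (auto intro!: derivative_eq_intros smooth_on_interval_has_deriv smooth_on_interval_deriv)
  then show ?thesis
    by (rule DERIV_cong) (use assms(3) in \<open>simp add: field_simps power2_eq_square\<close>)
qed

text \<open>Covers \<open>u_inv\<close> and \<open>u_exact\<close> together, as they share this
  \<open>x\<close>-coefficient. The square in the derivative of \<open>-g'/g\<close> cancels the
  quadratic term of the reduced equation.\<close>

lemma solves_ZK_log_deriv_iff:
  assumes T: "open T" and g: "smooth_on_interval T g" "\<forall>t\<in>T. g t \<noteq> 0"
    and A: "smooth_on_interval T A" and C: "smooth_on_interval T C"
    and u: "\<And>t x y. t \<in> T \<Longrightarrow> u (t, x, y) = A t + - (deriv g t / g t) * x + C t * y^2"
  shows "solves_ZK T u \<longleftrightarrow> (\<forall>t\<in>T. deriv (deriv g) t / g t + 2 * C t = 0)"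
proof -
  have "smooth_on_interval T (\<lambda>t. - (deriv g t / g t))"
    using g by (intro smooth_intros[OF T])
  from solves_ZK_quadratic_iff[OF T A this C u]
  have "solves_ZK T u \<longleftrightarrow> (\<forall>t\<in>T. deriv (\<lambda>t. - (deriv g t / g t)) t
      - (- (deriv g t / g t))^2 - 2 * C t = 0)" .
  moreover have "deriv (\<lambda>t. - (deriv g t / g t)) t - (- (deriv g t / g t))^2 - 2 * C t
      = - (deriv (deriv g) t / g t + 2 * C t)" if "t \<in> T" for t
    using DERIV_imp_deriv[OF deriv_minus_log_deriv[OF g(1) that]] g(2) that by simp
  ultimately show ?thesis
    by (simp only: neg_equal_0_iff_equal cong: ball_cong)
qed

lemma u_inv_quadratic:
  assumes "h t \<noteq> 0" "g t \<noteq> 0"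
  shows "u_inv g h w (t, x, y) = w t / (2 * h t * g t) + - (deriv g t / g t) * x
    + (deriv g t * deriv h t - g t * deriv (deriv h) t) / (2 * (2 * h t * g t)) * y^2"
  using assms by (simp add: u_inv_def field_simps)

text \<open>The coefficient of \<open>y^2\<close> is \<open>-g''/(2g)\<close>, so the reduced
  condition holds identically. The constants and \<open>G\<close> occur only in the part free of
  \<open>x\<close> and \<open>y\<close>, which the condition does not involve.\<close>

lemma solves_ZK_u_exact:
  assumes T: "open T" and g: "smooth_on_interval T g" "\<forall>t\<in>T. g t \<noteq> 0"
    and w: "smooth_on_interval T w"
    and G: "antiderivative_on T G (\<lambda>t. 1 / (g t)^3)"
    and nz: "\<forall>t\<in>T. \<alpha> - K * G t \<noteq> 0"
  shows "solves_ZK T (u_exact g \<alpha> K G w)"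
proof -
  have "smooth_on_interval T (\<lambda>t. 1 / (g t)^3)"
    using g by (intro smooth_intros[OF T]) auto
  then have "smooth_on_interval T G"
    by (rule smooth_on_interval_of_deriv[OF T]) (use G in \<open>auto simp: antiderivative_on_def\<close>)
  then have A: "smooth_on_interval T (\<lambda>t. w t / (2 * (g t)^3 * (\<alpha> - K * G t)))"
    using g w nz by (intro smooth_intros[OF T]) auto
  have C: "smooth_on_interval T (\<lambda>t. - (deriv (deriv g) t / g t / 2))"
    using g by (intro smooth_intros[OF T]) auto
  have "u_exact g \<alpha> K G w (t, x, y) = w t / (2 * (g t)^3 * (\<alpha> - K * G t))
      + - (deriv g t / g t) * x + - (deriv (deriv g) t / g t / 2) * y^2" if "t \<in> T" for t x y
  proof -
    define k where "k = \<alpha> - K * G t"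
    have "k \<noteq> 0" "g t \<noteq> 0" using nz g(2) that by (auto simp: k_def)
    then show ?thesis
      unfolding u_exact_def prod.case k_def[symmetric]
      by (simp add: field_simps power2_eq_square power3_eq_cube)
  qed
  from solves_ZK_log_deriv_iff[OF T g A C this] show ?thesis by simp
qed

theorem mainTheorem10:
  fixes T :: "real set" and g h w :: "real \<Rightarrow> real"
  assumes "open T" and "is_interval T" and "T \<noteq> {}"
    and "smooth_on_interval T g" and "\<forall>t\<in>T. g t \<noteq> 0"
    and "smooth_on_interval T h" and "\<forall>t\<in>T. h t \<noteq> 0"
    and "smooth_on_interval T w"
  shows
    "invariant_under T (x_field g) (u_inv g h w) \<and>
     invariant_under T (y_field h) (u_inv g h w) \<and>
     (solves_ZK T (u_inv g h w) \<longleftrightarrow>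
        (\<forall>t\<in>T. deriv g t * deriv h t + 2 * h t * deriv (deriv g) t - g t * deriv (deriv h) t = 0)) \<and>
     ((\<forall>t\<in>T. deriv g t * deriv h t + 2 * h t * deriv (deriv g) t - g t * deriv (deriv h) t = 0) \<longleftrightarrow>
        (\<exists>K. \<forall>t\<in>T. deriv h t - 2 * (deriv g t / g t) * h t + K / g t = 0)) \<and>
     (\<forall>G. antiderivative_on T G (\<lambda>t. 1 / (g t)^3) \<longrightarrow>
        (\<forall>K. (\<forall>t\<in>T. deriv h t - 2 * (deriv g t / g t) * h t + K / g t = 0) \<longleftrightarrow>
             (\<exists>\<alpha>. \<forall>t\<in>T. h t = \<alpha> * (g t)^2 - K * (g t)^2 * G t)) \<and>
        (\<forall>\<alpha> K. (\<forall>t\<in>T. h t = \<alpha> * (g t)^2 - K * (g t)^2 * G t) \<longrightarrow>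
             (\<forall>p\<in>spacetime T. u_inv g h w p = u_exact g \<alpha> K G w p)) \<and>
        (\<forall>\<alpha> K. (\<forall>t\<in>T. \<alpha> - K * G t \<noteq> 0) \<longrightarrow> solves_ZK T (u_exact g \<alpha> K G w)) \<and>
        (\<forall>\<alpha>. \<alpha> \<noteq> 0 \<longrightarrow>
             (\<forall>p\<in>spacetime T. u_exact g \<alpha> 0 G w p = u_exact0 g \<alpha> w p) \<and>
             solves_ZK T (u_exact0 g \<alpha> w)))"
proof -
  note T = assms(1) and g = assms(4,5) and h = assms(6,7) and w = assms(8)
  let ?ode = "\<forall>t\<in>T. deriv g t * deriv h t + 2 * h t * deriv (deriv g) t - g t * deriv (deriv h) t = 0"
  let ?A = "\<lambda>t. w t / (2 * h t * g t)"
  let ?B = "\<lambda>t. - (deriv g t / g t)"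
  \<comment> \<open>The outer 2 comes from \<open>y^2 / 2\<close>, the factor
    \<open>2 * h t * g t\<close> from the common denominator.\<close>
  let ?C = "\<lambda>t. (deriv g t * deriv h t - g t * deriv (deriv h) t) / (2 * (2 * h t * g t))"
  have smooth: "smooth_on_interval T ?A" "smooth_on_interval T ?B" "smooth_on_interval T ?C"
    by (intro smooth_intros[OF T] g h w; use g(2) h(2) in simp)+
  have u: "u_inv g h w (t, x, y) = ?A t + ?B t * x + ?C t * y^2" if "t \<in> T" for t x y
    using u_inv_quadratic g(2) h(2) that by blast
  have inv_x: "invariant_under T (x_field g) (u_inv g h w)"
  proof (rule invariant_under_quadratic[OF T smooth u])
    fix t x y :: real assume "t \<in> T"
    then have "x_field g (t, x, y, u_inv g h w (t, x, y)) =
        (0, g t, 0, ?B t * g t + 2 * ?C t * y * 0)"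
      using g(2) by (simp add: x_field_def)
    then show "\<exists>a b. x_field g (t, x, y, u_inv g h w (t, x, y)) =
        (0, a, b, ?B t * a + 2 * ?C t * y * b)"
      by blast
  qed
  have inv_y: "invariant_under T (y_field h) (u_inv g h w)"
  proof (rule invariant_under_quadratic[OF T smooth u])
    fix t x y :: real assume "t \<in> T"
    \<comment> \<open>The contributions of \<open>g'h'\<close> from the two summands cancel, leaving
      only the \<open>h''\<close> term.\<close>
    then have "- (1/2 * y * deriv (deriv h) t) = ?B t * (1/2 * y * deriv h t) + 2 * ?C t * y * h t"
      using g(2) h(2) by (simp add: field_simps)
    then show "\<exists>a b. y_field h (t, x, y, u_inv g h w (t, x, y)) =
        (0, a, b, ?B t * a + 2 * ?C t * y * b)"
      unfolding y_field_def prod.case by metis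
  qed
  \<comment> \<open>Multiplication by the nonzero factor \<open>2 * h t * g t\<close> links the two
    equations.\<close>
  have "deriv (deriv g) t / g t + 2 * ?C t = 0 \<longleftrightarrow>
      deriv g t * deriv h t + 2 * h t * deriv (deriv g) t - g t * deriv (deriv h) t = 0"
    if "t \<in> T" for t
    using g(2) h(2) that by (auto simp: field_simps)
  then have ZK: "solves_ZK T (u_inv g h w) \<longleftrightarrow> ?ode"
    using solves_ZK_log_deriv_iff[OF T g smooth(1,3) u] by auto
  have exact0: "u_exact g \<alpha> 0 G w = u_exact0 g \<alpha> w" for \<alpha> G
    by (auto simp: u_exact_def u_exact0_def mult_ac)
  \<comment> \<open>For \<open>K = 0\<close> the requirement that \<open>\<alpha> - K * G t\<close>
    be nonzero becomes \<open>\<alpha> \<noteq> 0\<close>.\<close>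
  have exact0_ZK: "solves_ZK T (u_exact0 g \<alpha> w)"
    if "antiderivative_on T G (\<lambda>t. 1 / (g t)^3)" "\<alpha> \<noteq> 0" for G \<alpha>
    using solves_ZK_u_exact[OF T g w that(1), of \<alpha> 0] that(2) by (simp add: exact0)
  show ?thesis
  proof (intro conjI allI impI inv_x inv_y ZK)
    show "?ode \<longleftrightarrow> (\<exists>K. \<forall>t\<in>T. deriv h t - 2 * (deriv g t / g t) * h t + K / g t = 0)"
      by (rule first_integral[OF T assms(2) g h(1)])
  next
    fix G K assume "antiderivative_on T G (\<lambda>t. 1 / (g t)^3)"
    then show "(\<forall>t\<in>T. deriv h t - 2 * (deriv g t / g t) * h t + K / g t = 0) \<longleftrightarrow>
        (\<exists>\<alpha>. \<forall>t\<in>T. h t = \<alpha> * (g t)^2 - K * (g t)^2 * G t)"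
      by (rule first_integral_solution[OF T assms(2) g h(1)])
  next
    fix G \<alpha> K assume "antiderivative_on T G (\<lambda>t. 1 / (g t)^3)"
      "\<forall>t\<in>T. h t = \<alpha> * (g t)^2 - K * (g t)^2 * G t"
    then show "\<forall>p\<in>spacetime T. u_inv g h w p = u_exact g \<alpha> K G w p"
      by (rule u_inv_eq_u_exact[OF T assms(2) g h(1) _ _ h(2)])
  next
    fix G \<alpha> K assume "antiderivative_on T G (\<lambda>t. 1 / (g t)^3)" "\<forall>t\<in>T. \<alpha> - K * G t \<noteq> 0"
    then show "solves_ZK T (u_exact g \<alpha> K G w)"
      by (rule solves_ZK_u_exact[OF T g w])
  qed (use exact0 exact0_ZK in auto)
qed

end
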